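(* Let $\Pi\subseteq\mathcal{R}^{d,r}$ be any set of functions from $\mathbb{R}^d$ to $\mathbb{R}^r$, let $N\in\mathbb{N}$, and let $\hat V_N^{\mathrm{SRO}},\hat V_N^{\mathrm{MP}},\hat V_N^{\mathrm{SP}}$ and $\hat v_N^{\mathrm{SRO}},\hat v_N^{\mathrm{MP}},\hat v_N^{\mathrm{SP}}$ be the optimal-cost functions and optimal costs of the sample robust problem, its multi-policy approximation, and its single-policy approximation (as defined in the context). Then $$\hat v_N^{\mathrm{SRO}}\le \hat v_N^{\mathrm{MP}}\le \hat v_N^{\mathrm{SP}}\qquad\text{and}\qquad \hat V_N^{\mathrm{SRO}}(\mathbf{x})\le \hat V_N^{\mathrm{MP}}(\mathbf{x})\le \hat V_N^{\mathrm{SP}}(\mathbf{x})\quad\text{for all }\mathbf{x}\in\mathbb{R}^n.$$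
   Context: Data: $\mathbf{c}\in\mathbb{R}^n$, $\mathbf{q}\in\mathbb{R}^r$, $\mathbf{T}\in\mathbb{R}^{m\times n}$, $\mathbf{W}\in\mathbb{R}^{m\times r}$, and an affine function $\mathbf{h}(\boldsymbol\zeta)=\mathbf{h}^0+\mathbf{H}\boldsymbol\zeta\in\mathbb{R}^m$ of $\boldsymbol\zeta\in\mathbb{R}^d$. $\Xi=\{\boldsymbol\zeta\in\mathbb{R}^d:\mathbf{G}\boldsymbol\zeta\ge\mathbf{g}^0\}$ is a polyhedron, $\boldsymbol\xi^1,\dots,\boldsymbol\xi^N\in\Xi$ are data points, $\epsilon_N\ge 0$, $\|\cdot\|$ is an $\ell_p$-norm, and $\mathcal{U}_N^i=\{\boldsymbol\zeta\in\Xi:\|\boldsymbol\zeta-\boldsymbol\xi^i\|\le\epsilon_N\}$ for $i\in[N]=\{1,\dots,N\}$. $\mathcal{R}^{d,r}$ is the space of all functions $\mathbb{R}^d\to\mathbb{R}^r$. Second-stage cost: $Q(\mathbf{x},\boldsymbol\zeta)=\inf\{\mathbf{q}^\top\mathbf{y}:\mathbf{y}\in\mathbb{R}^r,\ \mathbf{T}\mathbf{x}+\mathbf{W}\mathbf{y}\ge\mathbf{h}(\boldsymbol\zeta)\}$, equal to $+\infty$ if infeasible. Sample robust problem: $\hat V_N^{\mathrm{SRO}}(\mathbf{x})=\mathbf{c}^\top\mathbf{x}+\frac1N\sum_{i=1}^N\sup_{\boldsymbol\zeta\in\mathcal{U}_N^i}Q(\mathbf{x},\boldsymbol\zeta)$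 (a sum containing a term $+\infty$ equals $+\infty$), and $\hat v_N^{\mathrm{SRO}}=\inf_{\mathbf{x}\in\mathbb{R}^n}\hat V_N^{\mathrm{SRO}}(\mathbf{x})$. Single-policy approximation: $\hat V_N^{\mathrm{SP}}(\mathbf{x})$ is the infimum of $\mathbf{c}^\top\mathbf{x}+\frac1N\sum_{i=1}^N\sup_{\boldsymbol\zeta\in\mathcal{U}_N^i}\mathbf{q}^\top\mathbf{y}(\boldsymbol\zeta)$ over $\mathbf{y}(\cdot)\in\Pi$ satisfying $\mathbf{T}\mathbf{x}+\mathbf{W}\mathbf{y}(\boldsymbol\zeta)\ge\mathbf{h}(\boldsymbol\zeta)$ for all $\boldsymbol\zeta\in\bigcup_{i=1}^N\mathcal{U}_N^i$; it is $+\infty$ if there is no such policy. $\hat v_N^{\mathrm{SP}}=\inf_{\mathbf{x}}\hat V_N^{\mathrm{SP}}(\mathbf{x})$. Multi-policy approximation: $\hat V_N^{\mathrm{MP}}(\mathbf{x})$ is the infimum of $\mathbf{c}^\top\mathbf{x}+\frac1N\sum_{i=1}^N\sup_{\boldsymbol\zeta\in\mathcal{U}_N^i}\mathbf{q}^\top\mathbf{y}^i(\boldsymbol\zeta)$ over $\mathbf{y}^1(\cdot),\dots,\mathbf{y}^N(\cdot)\in\Pi$ satisfying $\mathbf{T}\mathbf{x}+\mathbf{W}\mathbf{y}^i(\boldsymbol\zeta)\ge\mathbf{h}(\boldsymbol\zeta)$ for all $\boldsymbol\zeta\in\mathcal{U}_N^i$ and all $i\in[N]$; it is $+\infty$ if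 there are no such policies. $\hat v_N^{\mathrm{MP}}=\inf_{\mathbf{x}}\hat V_N^{\mathrm{MP}}(\mathbf{x})$. *)

theory Defs
  imports "HOL-Analysis.Analysis"
begin

definition lp_norm :: "ereal \<Rightarrow> real ^ 'd \<Rightarrow> real" where
  "lp_norm p x =
     (if p = \<infinity> then infnorm x
      else (\<Sum>j\<in>UNIV. \<bar>x $ j\<bar> powr real_of_ereal p) powr (1 / real_of_ereal p))"

definition uncertainty_set ::
  "ereal \<Rightarrow> (real ^ 'd) set \<Rightarrow> (nat \<Rightarrow> real ^ 'd) \<Rightarrow> real \<Rightarrow> nat \<Rightarrow> (real ^ 'd) set" where
  "uncertainty_set p \<Xi> \<xi> \<epsilon> i = {\<zeta> \<in> \<Xi>. lp_norm p (\<zeta> - \<xi> i) \<le> \<epsilon>}"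

text \<open>
  In the definitions below, \<open>\<le>\<close> on vectors is the componentwise order of the library.
  Costs are extended reals: the infimum over the empty set is \<open>\<infinity>\<close>, and since
  \<open>\<infinity> + (-\<infinity>) = \<infinity>\<close> in \<^typ>\<open>ereal\<close>, a sum containing a term \<open>\<infinity>\<close> is \<open>\<infinity>\<close>.
\<close>

definition second_stage_cost ::
  "real ^ 'r \<Rightarrow> real ^ 'n ^ 'm \<Rightarrow> real ^ 'r ^ 'm \<Rightarrow> (real ^ 'd \<Rightarrow> real ^ 'm)
    \<Rightarrow> real ^ 'n \<Rightarrow> real ^ 'd \<Rightarrow> ereal" where
  "second_stage_cost q T W h x \<zeta> =
     (INF y\<in>{y. h \<zeta> \<le> T *v x + W *v y}. ereal (q \<bullet> y))"

definition V_SRO ::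
  "real ^ 'n \<Rightarrow> real ^ 'r \<Rightarrow> real ^ 'n ^ 'm \<Rightarrow> real ^ 'r ^ 'm \<Rightarrow> (real ^ 'd \<Rightarrow> real ^ 'm)
    \<Rightarrow> nat \<Rightarrow> (nat \<Rightarrow> (real ^ 'd) set) \<Rightarrow> real ^ 'n \<Rightarrow> ereal" where
  "V_SRO c q T W h N U x =
     ereal (c \<bullet> x) + ereal (1 / real N) * (\<Sum>i=1..N. SUP \<zeta>\<in>U i. second_stage_cost q T W h x \<zeta>)"

definition V_SP ::
  "real ^ 'n \<Rightarrow> real ^ 'r \<Rightarrow> real ^ 'n ^ 'm \<Rightarrow> real ^ 'r ^ 'm \<Rightarrow> (real ^ 'd \<Rightarrow> real ^ 'm)
    \<Rightarrow> nat \<Rightarrow> (nat \<Rightarrow> (real ^ 'd) set) \<Rightarrow> (real ^ 'd \<Rightarrow> real ^ 'r) set \<Rightarrow> real ^ 'n \<Rightarrow> ereal" where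
  "V_SP c q T W h N U \<P> x =
     (INF y\<in>{y \<in> \<P>. \<forall>\<zeta>\<in>(\<Union>i\<in>{1..N}. U i). h \<zeta> \<le> T *v x + W *v y \<zeta>}.
        ereal (c \<bullet> x) + ereal (1 / real N) * (\<Sum>i=1..N. SUP \<zeta>\<in>U i. ereal (q \<bullet> y \<zeta>)))"

definition V_MP ::
  "real ^ 'n \<Rightarrow> real ^ 'r \<Rightarrow> real ^ 'n ^ 'm \<Rightarrow> real ^ 'r ^ 'm \<Rightarrow> (real ^ 'd \<Rightarrow> real ^ 'm)
    \<Rightarrow> nat \<Rightarrow> (nat \<Rightarrow> (real ^ 'd) set) \<Rightarrow> (real ^ 'd \<Rightarrow> real ^ 'r) set \<Rightarrow> real ^ 'n \<Rightarrow> ereal" where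
  "V_MP c q T W h N U \<P> x =
     (INF Y\<in>{Y. \<forall>i\<in>{1..N}. Y i \<in> \<P> \<and> (\<forall>\<zeta>\<in>U i. h \<zeta> \<le> T *v x + W *v Y i \<zeta>)}.
        ereal (c \<bullet> x) + ereal (1 / real N) * (\<Sum>i=1..N. SUP \<zeta>\<in>U i. ereal (q \<bullet> Y i \<zeta>)))"

definition v_SRO ::
  "real ^ 'n \<Rightarrow> real ^ 'r \<Rightarrow> real ^ 'n ^ 'm \<Rightarrow> real ^ 'r ^ 'm \<Rightarrow> (real ^ 'd \<Rightarrow> real ^ 'm)
    \<Rightarrow> nat \<Rightarrow> (nat \<Rightarrow> (real ^ 'd) set) \<Rightarrow> ereal" where
  "v_SRO c q T W h N U = (INF x. V_SRO c q T W h N U x)"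

definition v_SP ::
  "real ^ 'n \<Rightarrow> real ^ 'r \<Rightarrow> real ^ 'n ^ 'm \<Rightarrow> real ^ 'r ^ 'm \<Rightarrow> (real ^ 'd \<Rightarrow> real ^ 'm)
    \<Rightarrow> nat \<Rightarrow> (nat \<Rightarrow> (real ^ 'd) set) \<Rightarrow> (real ^ 'd \<Rightarrow> real ^ 'r) set \<Rightarrow> ereal" where
  "v_SP c q T W h N U \<P> = (INF x. V_SP c q T W h N U \<P> x)"

definition v_MP ::
  "real ^ 'n \<Rightarrow> real ^ 'r \<Rightarrow> real ^ 'n ^ 'm \<Rightarrow> real ^ 'r ^ 'm \<Rightarrow> (real ^ 'd \<Rightarrow> real ^ 'm)
    \<Rightarrow> nat \<Rightarrow> (nat \<Rightarrow> (real ^ 'd) set) \<Rightarrow> (real ^ 'd \<Rightarrow> real ^ 'r) set \<Rightarrow> ereal" where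
  "v_MP c q T W h N U \<P> = (INF x. V_MP c q T W h N U \<P> x)"

end

theory Submission
  imports Defs
begin

text \<open>Each problem restricts the recourse decisions of the one before it. In the sample robust
  problem the recourse may be chosen afresh for every scenario; in the multi-policy problem it must
  come from one policy in \<open>\<P>\<close> per uncertainty set; in the single-policy problem
  these policies must coincide. Shrinking the feasible set can only raise an infimum, which gives
  \<open>V_SRO_le_V_MP\<close> and \<open>V_MP_le_V_SP\<close> for each fixed x. Taking infima over
  x preserves both inequalities.\<close>

lemma V_SRO_le_V_MP: "V_SRO c q T W h N U x \<le> V_MP c q T W h N U \<P> x"
  unfolding V_MP_def
proof (rule INF_greatest)
  fix Y assume Y: "Y \<in> {Y. \<forall>i\<in>{1..N}. Y i \<in> \<P> \<and> (\<forall>\<zeta>\<in>U i. h \<zeta> \<le> T *v x + W *v Y i \<zeta>)}"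
  have "(SUP \<zeta>\<in>U i. second_stage_cost q T W h x \<zeta>) \<le> (SUP \<zeta>\<in>U i. ereal (q \<bullet> Y i \<zeta>))"
    if "i \<in> {1..N}" for i
    \<comment> \<open>For \<zeta> in \<open>U i\<close>, the vector \<open>Y i \<zeta>\<close> is
      feasible in the second-stage problem at \<zeta>, so its cost bounds that infimum from
      above.\<close>
    unfolding second_stage_cost_def using Y that by (intro SUP_subset_mono INF_lower) auto
  then show "V_SRO c q T W h N U x
      \<le> ereal (c \<bullet> x) + ereal (1 / real N) * (\<Sum>i=1..N. SUP \<zeta>\<in>U i. ereal (q \<bullet> Y i \<zeta>))"
    \<comment> \<open>Addition and scaling by the nonnegative 1/N are monotone on
      \<open>ereal\<close>, so infinite suprema need no separate case.\<close>
    unfolding V_SRO_def by (intro add_left_mono ereal_mult_left_mono sum_mono) auto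
qed

text \<open>A feasible single policy, repeated for every index, is a feasible family with the same
  cost: feasibility on the union of the sets \<open>U i\<close> is feasibility on each of
  them.\<close>

lemma V_MP_le_V_SP: "V_MP c q T W h N U \<P> x \<le> V_SP c q T W h N U \<P> x"
  unfolding V_SP_def
proof (rule INF_greatest)
  fix y assume "y \<in> {y \<in> \<P>. \<forall>\<zeta>\<in>(\<Union>i\<in>{1..N}. U i). h \<zeta> \<le> T *v x + W *v y \<zeta>}"
  then show "V_MP c q T W h N U \<P> x
      \<le> ereal (c \<bullet> x) + ereal (1 / real N) * (\<Sum>i=1..N. SUP \<zeta>\<in>U i. ereal (q \<bullet> y \<zeta>))"
    unfolding V_MP_def by (intro INF_lower2[where i = "\<lambda>_. y"]) auto
qed

theorem theorem1:
  fixes c :: "real ^ 'n" and q :: "real ^ 'r"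
    and T :: "real ^ 'n ^ 'm" and W :: "real ^ 'r ^ 'm"
    and h0 :: "real ^ 'm" and H :: "real ^ 'd ^ 'm" and h :: "real ^ 'd \<Rightarrow> real ^ 'm"
    and G :: "real ^ 'd ^ 'k" and g0 :: "real ^ 'k" and \<Xi> :: "(real ^ 'd) set"
    and N :: nat and \<xi> :: "nat \<Rightarrow> real ^ 'd" and \<epsilon> :: real and p :: ereal
    and U :: "nat \<Rightarrow> (real ^ 'd) set"
    and \<P> :: "(real ^ 'd \<Rightarrow> real ^ 'r) set"
  assumes h: "h = (\<lambda>\<zeta>. h0 + H *v \<zeta>)"
    and Xi: "\<Xi> = {\<zeta>. G *v \<zeta> \<ge> g0}"
    and N: "N \<ge> 1"
    and data: "\<And>i. i \<in> {1..N} \<Longrightarrow> \<xi> i \<in> \<Xi>"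
    and eps: "\<epsilon> \<ge> 0"
    and p: "p \<ge> 1"
    and U: "U = uncertainty_set p \<Xi> \<xi> \<epsilon>"
  shows "(v_SRO c q T W h N U \<le> v_MP c q T W h N U \<P>
          \<and> v_MP c q T W h N U \<P> \<le> v_SP c q T W h N U \<P>)
       \<and> (\<forall>x. V_SRO c q T W h N U x \<le> V_MP c q T W h N U \<P> x
              \<and> V_MP c q T W h N U \<P> x \<le> V_SP c q T W h N U \<P> x)"
  unfolding v_SRO_def v_MP_def v_SP_def
  by (auto intro!: INF_mono' V_SRO_le_V_MP V_MP_le_V_SP)

end
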